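(* Let $\exists X[F]$ be an $\exists$CNF formula. Suppose the D-sequents $(\exists X[F],q',W')\rightarrow Z$ and $(\exists X[F],q'',W'')\rightarrow Z$ hold and $\mathrm{Vars}(q')\cap W''=\mathrm{Vars}(q'')\cap W'=\emptyset$. Let $q'$ and $q''$ be resolvable on a variable $v\in\mathrm{Vars}(F)$ and let $q$ be the resolvent of $q'$ and $q''$ on $v$. Then the D-sequent $(\exists X[F],q,W'\cup W'')\rightarrow Z$ holds too.
   Context: A clause is a disjunction of literals of Boolean variables; a CNF formula $F$ is a (finite) set of clauses, understood as their conjunction. $\mathrm{Vars}(\cdot)$ denotes the set of variables of a clause, formula or assignment. Assignments may be partial and are treated as sets of single-variable value assignments. An $\exists$CNF formula is $\exists X[F]$ with $X\subseteq\mathrm{Vars}(F)$; $\equiv$ means equality of truth values under every complete assignment to the free (non-$X$) variables. For an assignment $q$, $F_q$ is obtained from $F$ by removing all clauses satisfied by $q$ and deleting from the remaining clauses all literals falsified by $q$. Redundancy: $F^Z$ is the set of clauses of $F$ containing a variable of $Z$. The variables of $Z$ are redundant in $\exists X[F]$ if $\exists X[F]\equiv\exists X[F\setminus F^Z]$ (also used with $F_q$ in place of $F$, where $X$ need not be contained in $\mathrm{Vars}(F_q)$). Boundary points: a point of $F$ is an assignment $p$ with $\mathrm{Vars}(F)\subseteq\mathrm{Vars}(p)$. It is a $V$-boundary point of $F$ if $V\neq\emptyset$, $p$ falsifies $F$, every clause of $F$ falsified by $p$ contains a variable of $V$, and the last condition fails for every proper subset of $V$. Scoped redundancy: for $Z\subseteq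 X$ and $W\supseteq Z$, the variables of $Z$ are redundant in $\exists X[F]$ with scope $W$ if they are redundant in $\exists X[F]$ and, for every non-empty $V\subseteq Z$, every $V$-boundary point of $F$ can be turned into an assignment satisfying $F$ by changing only values of variables of $W$. D-sequents: let $q$ be an assignment to variables of $F$ and $Z\subseteq W\subseteq X\setminus\mathrm{Vars}(q)$. The D-sequent $(\exists X[F],q,W)\rightarrow Z$ states (holds iff) the variables of $Z$ are redundant in $\exists X[F_q]$ with scope $W$. Assignments $q',q''$ are resolvable on $v$ if $v$ is the only variable of $\mathrm{Vars}(q')\cap\mathrm{Vars}(q'')$ assigned different values in $q'$ and $q''$; their resolvent on $v$ is the assignment consisting of all assignments of $q'$ and $q''$ except those to $v$. *)

theory Defs
  imports Main
begin

section \<open>CNF formulas and partial assignments\<close>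

datatype 'a literal = Pos (var: 'a) | Neg (var: 'a)

type_synonym 'a clause = "'a literal set"
type_synonym 'a formula = "'a clause set"
type_synonym 'a assignment = "'a \<rightharpoonup> bool"

definition cnf :: "'a formula \<Rightarrow> bool" where
  "cnf F \<longleftrightarrow> finite F \<and> (\<forall>C\<in>F. finite C)"

definition vars_clause :: "'a clause \<Rightarrow> 'a set" where
  "vars_clause C = var ` C"

definition vars :: "'a formula \<Rightarrow> 'a set" where
  "vars F = (\<Union>C\<in>F. vars_clause C)"

definition exists_cnf :: "'a set \<Rightarrow> 'a formula \<Rightarrow> bool" where
  "exists_cnf X F \<longleftrightarrow> cnf F \<and> X \<subseteq> vars F"

text \<open>A literal on a variable that \<open>p\<close> leaves unassigned is neither satisfied nor falsified.\<close>

fun sat_literal :: "'a assignment \<Rightarrow> 'a literal \<Rightarrow> bool" where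
  "sat_literal p (Pos x) \<longleftrightarrow> p x = Some True"
| "sat_literal p (Neg x) \<longleftrightarrow> p x = Some False"

fun falsifies_literal :: "'a assignment \<Rightarrow> 'a literal \<Rightarrow> bool" where
  "falsifies_literal p (Pos x) \<longleftrightarrow> p x = Some False"
| "falsifies_literal p (Neg x) \<longleftrightarrow> p x = Some True"

definition sat_clause :: "'a assignment \<Rightarrow> 'a clause \<Rightarrow> bool" where
  "sat_clause p C \<longleftrightarrow> (\<exists>l\<in>C. sat_literal p l)"

definition falsifies_clause :: "'a assignment \<Rightarrow> 'a clause \<Rightarrow> bool" where
  "falsifies_clause p C \<longleftrightarrow> (\<forall>l\<in>C. falsifies_literal p l)"

definition sat :: "'a assignment \<Rightarrow> 'a formula \<Rightarrow> bool" where
  "sat p F \<longleftrightarrow> (\<forall>C\<in>F. sat_clause p C)"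

definition falsifies :: "'a assignment \<Rightarrow> 'a formula \<Rightarrow> bool" where
  "falsifies p F \<longleftrightarrow> (\<exists>C\<in>F. falsifies_clause p C)"

definition cofactor :: "'a formula \<Rightarrow> 'a assignment \<Rightarrow> 'a formula" where
  "cofactor F q = {{l \<in> C. \<not> falsifies_literal q l} | C. C \<in> F \<and> \<not> sat_clause q C}"


section \<open>Redundancy of variables\<close>

definition exists_true :: "'a set \<Rightarrow> 'a formula \<Rightarrow> 'a assignment \<Rightarrow> bool" where
  "exists_true X F y \<longleftrightarrow> (\<exists>x. dom x = X \<and> sat (y ++ x) F)"

definition exists_equiv :: "'a set \<Rightarrow> 'a formula \<Rightarrow> 'a formula \<Rightarrow> bool" where
  "exists_equiv X F G \<longleftrightarrow>
     (\<forall>y. dom y = (vars F \<union> vars G) - X \<longrightarrow> exists_true X F y = exists_true X G y)"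

definition clauses_with :: "'a formula \<Rightarrow> 'a set \<Rightarrow> 'a formula" where
  "clauses_with F Z = {C \<in> F. vars_clause C \<inter> Z \<noteq> {}}"

text \<open>\<open>X\<close> need not be contained in \<open>vars F\<close> here: \<open>F\<close> may be a cofactor in which
  some of the quantified variables no longer occur.\<close>

definition redundant :: "'a set \<Rightarrow> 'a formula \<Rightarrow> 'a set \<Rightarrow> bool" where
  "redundant X F Z \<longleftrightarrow> exists_equiv X F (F - clauses_with F Z)"

definition point :: "'a formula \<Rightarrow> 'a assignment \<Rightarrow> bool" where
  "point F p \<longleftrightarrow> vars F \<subseteq> dom p"

definition boundary_point :: "'a formula \<Rightarrow> 'a set \<Rightarrow> 'a assignment \<Rightarrow> bool" where
  "boundary_point F V p \<longleftrightarrow>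
     point F p \<and> V \<noteq> {} \<and> falsifies p F \<and>
     (\<forall>C\<in>F. falsifies_clause p C \<longrightarrow> vars_clause C \<inter> V \<noteq> {}) \<and>
     (\<forall>U. U \<subset> V \<longrightarrow> \<not> (\<forall>C\<in>F. falsifies_clause p C \<longrightarrow> vars_clause C \<inter> U \<noteq> {}))"

definition repairable :: "'a formula \<Rightarrow> 'a set \<Rightarrow> 'a assignment \<Rightarrow> bool" where
  "repairable F W p \<longleftrightarrow>
     (\<exists>p'. dom p' = dom p \<and> (\<forall>x. x \<notin> W \<longrightarrow> p' x = p x) \<and> sat p' F)"

definition redundant_scope :: "'a set \<Rightarrow> 'a formula \<Rightarrow> 'a set \<Rightarrow> 'a set \<Rightarrow> bool" where
  "redundant_scope X F Z W \<longleftrightarrow>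
     Z \<subseteq> X \<and> Z \<subseteq> W \<and> redundant X F Z \<and>
     (\<forall>V. V \<noteq> {} \<and> V \<subseteq> Z \<longrightarrow> (\<forall>p. boundary_point F V p \<longrightarrow> repairable F W p))"


section \<open>D-sequents and their resolution\<close>

text \<open>\<open>dsequent X F q W Z\<close> says that \<open>(\<exists>X[F], q, W) \<rightarrow> Z\<close> is a well-formed D-sequent
  and that it holds.\<close>

definition dsequent ::
  "'a set \<Rightarrow> 'a formula \<Rightarrow> 'a assignment \<Rightarrow> 'a set \<Rightarrow> 'a set \<Rightarrow> bool" where
  "dsequent X F q W Z \<longleftrightarrow>
     dom q \<subseteq> vars F \<and> Z \<subseteq> W \<and> W \<subseteq> X - dom q \<and> redundant_scope X (cofactor F q) Z W"

definition resolvable :: "'a assignment \<Rightarrow> 'a assignment \<Rightarrow> 'a \<Rightarrow> bool" where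
  "resolvable q' q'' v \<longleftrightarrow> {x \<in> dom q' \<inter> dom q''. q' x \<noteq> q'' x} = {v}"

text \<open>The bias of \<open>++\<close> towards its right argument matters only where the two assignments
  disagree; when they are resolvable on \<open>v\<close>, that is at \<open>v\<close> alone, which is then unassigned.\<close>

definition resolvent :: "'a assignment \<Rightarrow> 'a assignment \<Rightarrow> 'a \<Rightarrow> 'a assignment" where
  "resolvent q' q'' v = (q' ++ q'')(v := None)"

end

theory Submission
  imports Defs
begin

text \<open>
  Overwriting a boundary point of \<open>F\<^sub>q\<close> by \<open>q\<close>, and by whichever of \<open>q'\<close>, \<open>q''\<close> agrees with it
  at \<open>v\<close>, yields a point at which \<open>F\<close>, \<open>F\<^sub>q\<close> and (say) \<open>F\<^bsub>q'\<^esub>\<close> have the same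
  boundary behaviour; a repair over \<open>W'\<close> for \<open>F\<^bsub>q'\<^esub>\<close> is therefore one for \<open>F\<^sub>q\<close>.
  Redundancy of \<open>Z\<close> follows from this: an assignment satisfying
  the clauses of \<open>F\<^sub>q\<close> free of \<open>Z\<close> either satisfies \<open>F\<^sub>q\<close> or is a \<open>V\<close>-boundary point for a
  minimal \<open>V \<subseteq> Z\<close> meeting all falsified clauses, and repairs only change variables of \<open>X\<close>.
\<close>

section \<open>Literals, clauses and agreement of assignments\<close>

lemma sat_literal_iff: "sat_literal p l \<longleftrightarrow> p (var l) = Some (case l of Pos _ \<Rightarrow> True | Neg _ \<Rightarrow> False)"
  by (cases l) auto

lemma falsifies_literal_iff:
  "falsifies_literal p l \<longleftrightarrow> p (var l) = Some (case l of Pos _ \<Rightarrow> False | Neg _ \<Rightarrow> True)"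
  by (cases l) auto

lemma literal_mono:
  assumes "q \<subseteq>\<^sub>m p"
  shows "sat_literal q l \<Longrightarrow> sat_literal p l" "falsifies_literal q l \<Longrightarrow> falsifies_literal p l"
  using assms by (auto simp: sat_literal_iff falsifies_literal_iff map_le_def dom_def)

lemma not_sat_and_falsifies_literal: "\<not> (sat_literal p l \<and> falsifies_literal p l)"
  by (cases l) auto

lemma literal_total:
  "var l \<in> dom p \<Longrightarrow> sat_literal p l \<or> falsifies_literal p l"
  by (cases l) auto

lemma var_in_vars: "C \<in> F \<Longrightarrow> l \<in> C \<Longrightarrow> var l \<in> vars F"
  by (auto simp: vars_def vars_clause_def)

lemma finite_vars: "cnf F \<Longrightarrow> finite (vars F)"
  by (auto simp: cnf_def vars_def vars_clause_def)

text \<open>A literal on a variable assigned by \<open>q\<close> is either satisfied, and its clause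
  is dropped, or falsified, and the literal is deleted.\<close>

lemma vars_cofactor_subset: "vars (cofactor F q) \<subseteq> vars F - dom q"
proof
  fix x assume "x \<in> vars (cofactor F q)"
  then obtain C l where l: "C \<in> F" "\<not> sat_clause q C" "l \<in> C" "\<not> falsifies_literal q l" "x = var l"
    by (auto simp: vars_def vars_clause_def cofactor_def)
  then have "\<not> sat_literal q l" by (auto simp: sat_clause_def)
  with l literal_total[of l q] show "x \<in> vars F - dom q"
    by (auto intro: var_in_vars)
qed

lemma falsifies_clause_cong:
  "(\<And>x. x \<in> vars_clause C \<Longrightarrow> p x = r x) \<Longrightarrow> falsifies_clause p C \<longleftrightarrow> falsifies_clause r C"
  by (auto simp: falsifies_clause_def falsifies_literal_iff vars_clause_def)

lemma sat_cong:
  assumes "\<And>x. x \<in> vars F \<Longrightarrow> p x = r x"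
  shows "sat p F \<longleftrightarrow> sat r F"
  using assms by (auto simp: sat_def sat_clause_def sat_literal_iff var_in_vars)

lemma boundary_point_cong:
  assumes "\<And>x. x \<in> vars F \<Longrightarrow> p x = r x"
  shows "boundary_point F V p \<longleftrightarrow> boundary_point F V r"
proof -
  have "falsifies_clause p C \<longleftrightarrow> falsifies_clause r C" if "C \<in> F" for C
    using assms that by (intro falsifies_clause_cong) (auto simp: vars_def)
  moreover have "vars F \<subseteq> dom p \<longleftrightarrow> vars F \<subseteq> dom r"
    using assms by (auto simp: subset_iff domIff)
  ultimately show ?thesis
    unfolding boundary_point_def point_def falsifies_def by simp
qed

section \<open>Passing between a formula and its cofactors\<close>

lemma falsifies_clause_imp_not_sat_clause:
  "q \<subseteq>\<^sub>m p \<Longrightarrow> falsifies_clause p C \<Longrightarrow> \<not> sat_clause q C"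
  unfolding falsifies_clause_def sat_clause_def
  using literal_mono(1) not_sat_and_falsifies_literal by blast

lemma falsifies_clause_cofactor:
  "q \<subseteq>\<^sub>m p \<Longrightarrow> falsifies_clause p {l \<in> C. \<not> falsifies_literal q l} \<longleftrightarrow> falsifies_clause p C"
  unfolding falsifies_clause_def using literal_mono(2) by blast

lemma vars_clause_cofactor:
  assumes "V \<inter> dom q = {}"
  shows "vars_clause {l \<in> C. \<not> falsifies_literal q l} \<inter> V = vars_clause C \<inter> V"
  using assms by (auto simp: vars_clause_def falsifies_literal_iff)

lemma sat_cofactor:
  assumes "q \<subseteq>\<^sub>m p"
  shows "sat p (cofactor F q) \<longleftrightarrow> sat p F"
proof -
  have "sat_clause p {l \<in> C. \<not> falsifies_literal q l} \<longleftrightarrow> sat_clause p C" for C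
    unfolding sat_clause_def using literal_mono(2)[OF assms] not_sat_and_falsifies_literal by blast
  moreover have "sat_clause q C \<Longrightarrow> sat_clause p C" for C
    unfolding sat_clause_def using literal_mono(1)[OF assms] by blast
  ultimately show ?thesis unfolding sat_def cofactor_def by auto
qed

text \<open>Clauses dropped from the cofactor are satisfied by \<open>q\<close>, so no extension
  \<open>p\<close> falsifies them. The surviving clauses lose only literals already false under
  \<open>p\<close>, and these lie on variables outside \<open>V\<close>.\<close>

lemma falsified_hit_cofactor:
  assumes "q \<subseteq>\<^sub>m p" "V \<inter> dom q = {}"
  shows "(\<forall>C\<in>cofactor F q. falsifies_clause p C \<longrightarrow> vars_clause C \<inter> V \<noteq> {})
    \<longleftrightarrow> (\<forall>C\<in>F. falsifies_clause p C \<longrightarrow> vars_clause C \<inter> V \<noteq> {})"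
proof -
  have "(\<forall>C\<in>cofactor F q. falsifies_clause p C \<longrightarrow> vars_clause C \<inter> V \<noteq> {})
    \<longleftrightarrow> (\<forall>C\<in>F. \<not> sat_clause q C \<longrightarrow> falsifies_clause p {l \<in> C. \<not> falsifies_literal q l}
          \<longrightarrow> vars_clause {l \<in> C. \<not> falsifies_literal q l} \<inter> V \<noteq> {})"
    unfolding cofactor_def by blast
  then show ?thesis
    unfolding falsifies_clause_cofactor[OF assms(1)] vars_clause_cofactor[OF assms(2)]
    using falsifies_clause_imp_not_sat_clause[OF assms(1)] by blast
qed

lemma falsifies_cofactor:
  assumes "q \<subseteq>\<^sub>m p"
  shows "falsifies p (cofactor F q) \<longleftrightarrow> falsifies p F"
  \<comment> \<open>For \<open>V = {}\<close> the hitting condition says that no clause is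
    falsified.\<close>
  using falsified_hit_cofactor[OF assms, of "{}" F] by (auto simp: falsifies_def)

lemma boundary_point_cofactor:
  assumes "q \<subseteq>\<^sub>m p" "V \<inter> dom q = {}" "vars F \<subseteq> dom p"
  shows "boundary_point (cofactor F q) V p \<longleftrightarrow> boundary_point F V p"
proof -
  have "point (cofactor F q) p" "point F p"
    using assms(3) vars_cofactor_subset[of F q] by (auto simp: point_def)
  \<comment> \<open>Minimality of \<open>V\<close> requires the transfer for its proper subsets as
    well.\<close>
  moreover have "U \<inter> dom q = {}" if "U \<subset> V" for U using assms(2) that by auto
  ultimately show ?thesis
    unfolding boundary_point_def
    using falsifies_cofactor[OF assms(1)] falsified_hit_cofactor[OF assms(1)] assms(2) by simp
qed

lemma repairable_mono: "repairable F W p \<Longrightarrow> W \<subseteq> W' \<Longrightarrow> repairable F W' p"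
  unfolding repairable_def by blast

text \<open>Stated for one parent, so that it serves both. On \<open>dom q\<close> the point
  \<open>p\<close> may disagree with \<open>q'\<close>, because those variables do not occur in
  \<open>cofactor F q\<close>.\<close>

lemma repairable_cofactor:
  assumes ds: "dsequent X F q' W Z"
    and disj: "dom q \<inter> W = {}"
    and compat: "\<And>x. x \<in> dom q \<inter> dom q' \<Longrightarrow> q x = q' x"
    and compat_p: "\<And>x. x \<in> dom p \<inter> dom q' - dom q \<Longrightarrow> p x = q' x"
    and V: "V \<subseteq> Z" and bp: "boundary_point (cofactor F q) V p"
  shows "repairable (cofactor F q) W p"
proof -
  \<comment> \<open>Later summands win: \<open>q\<close> over \<open>q'\<close> over
    \<open>p\<close>. The default \<open>True\<close> is there because \<open>p\<close> need not
    assign all of \<open>vars F\<close>.\<close>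
  define r where "r = (\<lambda>x. if x \<in> vars F then Some True else None) ++ p ++ q' ++ q"
  have W: "W \<inter> dom q' = {}" and ZW: "Z \<subseteq> W"
    and rep: "\<And>V p. V \<noteq> {} \<Longrightarrow> V \<subseteq> Z \<Longrightarrow> boundary_point (cofactor F q') V p
      \<Longrightarrow> repairable (cofactor F q') W p"
    using ds by (auto simp: dsequent_def redundant_scope_def)
  have r_q: "q \<subseteq>\<^sub>m r" by (simp add: r_def)
  have r_q': "q' \<subseteq>\<^sub>m r"
    unfolding map_le_def
  proof
    fix x assume "x \<in> dom q'"
    then show "q' x = r x"
      using compat[of x] by (cases "x \<in> dom q") (simp_all add: r_def map_add_dom_app_simps)
  qed
  have r_p: "r x = p x" if "x \<in> dom p - dom q" for x
    using compat_p[of x] that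
    by (cases "x \<in> dom q'") (simp_all add: r_def map_add_dom_app_simps)
  have dom_r: "vars F \<subseteq> dom r" by (auto simp: r_def)
  have Vq: "V \<inter> dom q = {}" and Vq': "V \<inter> dom q' = {}"
    using V ZW W disj by blast+
  have pt: "vars (cofactor F q) \<subseteq> dom p - dom q"
    using bp vars_cofactor_subset[of F q] by (auto simp: boundary_point_def point_def)
  then have p_r: "p x = r x" if "x \<in> vars (cofactor F q)" for x
    using r_p[OF subsetD[OF _ that]] by simp
  then have "boundary_point (cofactor F q) V r"
    using bp boundary_point_cong[of "cofactor F q" p r] by blast
  \<comment> \<open>As \<open>r\<close> extends both \<open>q\<close> and \<open>q'\<close>, the
    transfer goes from one cofactor to the other through \<open>F\<close> itself.\<close>
  then have "boundary_point (cofactor F q') V r"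
    using boundary_point_cofactor[OF r_q Vq dom_r] boundary_point_cofactor[OF r_q' Vq' dom_r] by simp
  moreover have "V \<noteq> {}" using bp by (simp add: boundary_point_def)
  ultimately have "repairable (cofactor F q') W r" using rep V by blast
  then obtain s where s: "dom s = dom r" "\<And>x. x \<notin> W \<Longrightarrow> s x = r x" "sat s (cofactor F q')"
    by (auto simp: repairable_def)
  \<comment> \<open>The repair changes only variables of \<open>W\<close>, which misses both
    domains; hence both cofactors and \<open>F\<close> have the same truth value at
    \<open>s\<close>.\<close>
  have "q' \<subseteq>\<^sub>m s" "q \<subseteq>\<^sub>m s"
    using r_q r_q' s(2) W disj unfolding map_le_def by (metis disjoint_iff)+
  then have sat_s: "sat s (cofactor F q)" using s(3) by (simp add: sat_cofactor)
  \<comment> \<open>Off \<open>W\<close>, \<open>s\<close> follows \<open>r\<close>, which may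
    differ from \<open>p\<close> on \<open>dom q\<close> and outside \<open>dom p\<close>; so only
    the values on \<open>W\<close> within \<open>dom p\<close> are copied.\<close>
  define p' where "p' = (\<lambda>x. if x \<in> W \<inter> dom p then s x else p x)"
  have "dom p \<subseteq> dom s" unfolding s(1) by (auto simp: r_def)
  then have "dom p' = dom p"
    by (auto simp: p'_def dom_def split: if_splits)
  moreover have "p' x = s x" if "x \<in> vars (cofactor F q)" for x
    using subsetD[OF pt that] p_r[OF that] s(2)[of x] by (simp add: p'_def)
  then have "sat p' (cofactor F q)" using sat_s sat_cong by blast
  ultimately show ?thesis
    unfolding repairable_def by (intro exI[of _ p']) (auto simp: p'_def)
qed

section \<open>From repairs to redundancy\<close>

lemma minimal_subset_exists:
  assumes "finite A" "P A"
  obtains B where "B \<subseteq> A" "P B" "\<And>U. U \<subset> B \<Longrightarrow> \<not> P U"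
proof -
  have "finite {B. B \<subseteq> A \<and> P B}" "{B. B \<subseteq> A \<and> P B} \<noteq> {}"
    using assms by auto
  from finite_has_minimal[OF this] obtain B where
    "B \<subseteq> A" "P B" "\<And>U. U \<subseteq> A \<Longrightarrow> P U \<Longrightarrow> U \<subseteq> B \<Longrightarrow> B = U" by auto
  then show ?thesis by (intro that[of B]) auto
qed

lemma sat_or_boundary_point:
  assumes fin: "finite (vars F)" and pt: "point F p" and sat: "sat p (F - clauses_with F Z)"
  shows "sat p F \<or> (\<exists>V\<subseteq>Z. boundary_point F V p)"
proof (rule disjCI)
  assume none: "\<not> (\<exists>V\<subseteq>Z. boundary_point F V p)"
  show "sat p F"
  proof (rule ccontr)
    assume "\<not> sat p F"
    then obtain C where C: "C \<in> F" "\<not> sat_clause p C" by (auto simp: sat_def)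
    have fal: "falsifies_clause p C"
      unfolding falsifies_clause_def
    proof
      fix l assume l: "l \<in> C"
      then have "var l \<in> dom p" using pt var_in_vars[OF C(1)] by (auto simp: point_def)
      then show "falsifies_literal p l"
        using literal_total[of l p] C(2) l unfolding sat_clause_def by blast
    qed
    let ?P = "\<lambda>V. \<forall>C\<in>F. falsifies_clause p C \<longrightarrow> vars_clause C \<inter> V \<noteq> {}"
    \<comment> \<open>Intersecting with \<open>vars F\<close> makes the hitting set finite, so that
      it can be shrunk to a minimal one.\<close>
    have "?P (Z \<inter> vars F)"
    proof (intro ballI impI)
      fix D assume D: "D \<in> F" "falsifies_clause p D"
      then have "\<not> sat_clause p D"
        using falsifies_clause_imp_not_sat_clause[OF map_le_refl] by blast
      then have "D \<in> clauses_with F Z" using sat D(1) by (auto simp: sat_def)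
      then show "vars_clause D \<inter> (Z \<inter> vars F) \<noteq> {}"
        using D(1) by (auto simp: clauses_with_def vars_def)
    qed
    then obtain V where V: "V \<subseteq> Z \<inter> vars F" "?P V" "\<And>U. U \<subset> V \<Longrightarrow> \<not> ?P U"
      using fin by (rule_tac minimal_subset_exists[of "Z \<inter> vars F" ?P]) auto
    have "V \<noteq> {}" using V(2) C(1) fal by auto
    then have "boundary_point F V p"
      unfolding boundary_point_def falsifies_def using V(2,3) pt C(1) fal by blast
    then show False using none V(1) by auto
  qed
qed

lemma redundant_of_repairable:
  assumes fin: "finite (vars F)" and WX: "W \<subseteq> X"
    and rep: "\<And>V p. V \<subseteq> Z \<Longrightarrow> boundary_point F V p \<Longrightarrow> repairable F W p"
  shows "redundant X F Z"
  unfolding redundant_def exists_equiv_def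
proof (intro allI impI iffI)
  let ?G = "F - clauses_with F Z"
  fix y :: "'a assignment"
  assume y: "dom y = vars F \<union> vars ?G - X"
  {
    assume "exists_true X F y"
    then show "exists_true X ?G y" by (auto simp: exists_true_def sat_def)
  next
    assume "exists_true X ?G y"
    then obtain x where x: "dom x = X" "sat (y ++ x) ?G" by (auto simp: exists_true_def)
    have "point F (y ++ x)" using x(1) y by (auto simp: point_def)
    then consider "sat (y ++ x) F" | "repairable F W (y ++ x)"
      using sat_or_boundary_point[OF fin _ x(2)] rep by blast
    then show "exists_true X F y"
    proof cases
      case 1
      then show ?thesis using x(1) by (auto simp: exists_true_def)
    next
      case 2
      then obtain s where s: "dom s = dom (y ++ x)" "\<And>z. z \<notin> W \<Longrightarrow> s z = (y ++ x) z" "sat s F"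
        by (auto simp: repairable_def)
      \<comment> \<open>Since \<open>W\<close> lies in \<open>X\<close>, the repair leaves
        \<open>y\<close> intact, and the restriction of \<open>s\<close> to \<open>X\<close> is the
        new witness for the quantified variables.\<close>
      have "y ++ s |` X = s"
      proof
        fix z
        have "s z = y z" if "z \<notin> X"
          using that s(2)[of z] WX x(1) by (auto simp: map_add_dom_app_simps)
        moreover have "z \<in> dom s" if "z \<in> X" using that s(1) x(1) by auto
        ultimately show "(y ++ s |` X) z = s z"
          by (cases "z \<in> X") (auto simp: map_add_def restrict_map_def)
      qed
      moreover have "dom (s |` X) = X" using s(1) x(1) by auto
      ultimately show ?thesis using s(3) unfolding exists_true_def by metis
    qed
  }
qed

theorem proposition9:
  fixes X Z W' W'' :: "'a set" and F :: "'a formula"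
    and q' q'' q :: "'a assignment" and v :: 'a
  assumes "exists_cnf X F"
    and "dsequent X F q' W' Z"
    and "dsequent X F q'' W'' Z"
    and "dom q' \<inter> W'' = {}"
    and "dom q'' \<inter> W' = {}"
    and "v \<in> vars F"
    and "resolvable q' q'' v"
    and "q = resolvent q' q'' v"
  shows "dsequent X F q (W' \<union> W'') Z"
proof -
  have dom_q: "dom q = dom q' \<union> dom q'' - {v}"
    by (auto simp: assms(8) resolvent_def)
  have v: "q' v \<noteq> q'' v" "v \<in> dom q'" "v \<in> dom q''"
    and agree: "\<And>x. x \<in> dom q' \<Longrightarrow> x \<in> dom q'' \<Longrightarrow> x \<noteq> v \<Longrightarrow> q' x = q'' x"
    using assms(7) by (auto simp: resolvable_def)
  have q_q'': "q x = q'' x" if "x \<in> dom q \<inter> dom q''" for x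
    using that by (simp add: assms(8) resolvent_def map_add_dom_app_simps(1))
  have q_q': "q x = q' x" if "x \<in> dom q \<inter> dom q'" for x
  proof (cases "x \<in> dom q''")
    case True
    then show ?thesis using that q_q'' agree by (simp add: dom_q)
  next
    case False
    then show ?thesis using that
      by (simp add: assms(8) resolvent_def map_add_dom_app_simps(3))
  qed
  have ds: "dom q' \<subseteq> vars F" "dom q'' \<subseteq> vars F" "Z \<subseteq> W'" "Z \<subseteq> X"
    "W' \<subseteq> X - dom q'" "W'' \<subseteq> X - dom q''"
    using assms(2,3) by (simp_all add: dsequent_def redundant_scope_def)
  \<comment> \<open>The crossed disjointness assumptions keep each scope off the other parent's
    domain.\<close>
  have W: "W' \<union> W'' \<subseteq> X - dom q"
    unfolding dom_q using ds(5,6) assms(4,5) by blast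
  have dom: "dom q \<subseteq> vars F" unfolding dom_q using ds(1,2) by blast
  have Wq: "dom q \<inter> W' = {}" "dom q \<inter> W'' = {}" using W by blast+
  have rep: "repairable (cofactor F q) (W' \<union> W'') p"
    if V: "V \<subseteq> Z" and bp: "boundary_point (cofactor F q) V p" for V p
  proof -
    \<comment> \<open>The parents disagree at \<open>v\<close>, so their two values there exhaust
      the Booleans. If \<open>p\<close> leaves \<open>v\<close> unassigned, either parent will
      do.\<close>
    have "p v = None \<or> p v = q' v \<or> p v = q'' v"
      using v by (cases "p v") auto
    then consider "v \<in> dom p \<longrightarrow> p v = q' v" | "v \<in> dom p \<longrightarrow> p v = q'' v" by auto
    then show ?thesis
    proof cases
      case 1
      then have "p x = q' x" if "x \<in> dom p \<inter> dom q' - dom q" for x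
        using that by (cases "x = v") (auto simp: dom_q)
      then have "repairable (cofactor F q) W' p"
        using repairable_cofactor[OF assms(2) Wq(1) q_q' _ V bp] by blast
      then show ?thesis by (rule repairable_mono) simp
    next
      case 2
      then have "p x = q'' x" if "x \<in> dom p \<inter> dom q'' - dom q" for x
        using that by (cases "x = v") (auto simp: dom_q)
      then have "repairable (cofactor F q) W'' p"
        using repairable_cofactor[OF assms(3) Wq(2) q_q'' _ V bp] by blast
      then show ?thesis by (rule repairable_mono) simp
    qed
  qed
  have "finite (vars (cofactor F q))"
    using assms(1) finite_vars vars_cofactor_subset[of F q]
    by (auto simp: exists_cnf_def intro: finite_subset)
  then have "redundant X (cofactor F q) Z"
    using W rep by (intro redundant_of_repairable[of _ "W' \<union> W''"]) auto
  then show ?thesis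
    unfolding dsequent_def redundant_scope_def using W dom ds(3,4) rep by blast
qed

end
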